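(* Any two composition series of a groupoid $\mathcal{G}$ are equivalent.
   Context: A groupoid is a set $\mathcal{G}$ with a partial binary operation, written by concatenation ($\exists gh$ means that $gh$ is defined). An element $e$ is an identity if $\exists eg$ implies $eg=g$ and $\exists g'e$ implies $g'e=g'$; $\mathcal{G}_0$ is the set of identities. Axioms: (i) $\exists g(hl)$ iff $\exists (gh)l$, and then $g(hl)=(gh)l$; (ii) $\exists g(hl)$ iff $\exists gh$ and $\exists hl$; (iii) for each $g$ there are unique identities $d(g),r(g)$ with $\exists gd(g)$ and $\exists r(g)g$; (iv) for each $g$ there is $g^{-1}$ with $\exists g^{-1}g$, $\exists gg^{-1}$, $d(g)=g^{-1}g$, $r(g)=gg^{-1}$. (Thus $\exists gh$ iff $d(g)=r(h)$.) For $e\in\mathcal{G}_0$, $\mathcal{G}_e=\{g\in\mathcal{G}\mid d(g)=r(g)=e\}$. A subgroupoid is a nonempty subset closed under inverses and under defined products; it is wide if it has the same set of identities as $\mathcal{G}$. A subgroupoid $\mathcal{H}$ of $\mathcal{G}$ is normal, $\mathcal{H}\lhd\mathcal{G}$, if for all $g\in\mathcal{G}$ the set $g^{-1}\mathcal{H}g=\{g^{-1}hg\mid h\in\mathcal{H}\cap\mathcal{G}_{r(g)}\}$ is nonempty and contained in $\mathcal{H}$ (nonemptiness for all $g$ is equivalent to $\mathcal{H}$ being wide). For $\mathcal{H}\lhd\mathcal{G}$, write $g\equiv_{\mathcal{H}}l$ iff $\exists l^{-1}g$ and $l^{-1}g\in\mathcal{H}$; the class of $g$ is the left coset $g\mathcal{H}=\{gh\mid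 h\in\mathcal{H},\ r(h)=d(g)\}$. The quotient groupoid $\mathcal{G}/\mathcal{H}$ is the set of all left cosets of $\mathcal{H}$ in $\mathcal{G}$, with $\exists(g\mathcal{H})(l\mathcal{H})$ iff $\exists gl$, and partial binary operation $(g\mathcal{H})(l\mathcal{H})=gl\mathcal{H}$. A subnormal series of $\mathcal{G}$ is a chain of subgroupoids $\mathcal{G}=\mathcal{G}^{(0)}>\mathcal{G}^{(1)}>\cdots>\mathcal{G}^{(n)}$ (inclusions not necessarily strict) with $\mathcal{G}^{(i+1)}$ normal in $\mathcal{G}^{(i)}$ for $0\le i\le n-1$; its factors are the quotient groupoids $\mathcal{G}^{(i)}/\mathcal{G}^{(i+1)}$. A groupoid is simple if its only normal subgroupoids are itself and its set of identities. A composition series is a subnormal series with $\mathcal{G}^{(n)}=\mathcal{G}_0$ all of whose factors are simple. A factor is trivial if $\mathcal{G}^{(i)}=\mathcal{G}^{(i+1)}$. Two subnormal series are equivalent if there is a one-to-one correspondence between the nontrivial factors of one and the nontrivial factors of the other such that corresponding factors are isomorphic groupoids, where an isomorphism is a bijective map $\phi$ such that $\exists xy$ implies $\exists\phi(x)\phi(y)$ and $\phi(xy)=\phi(x)\phi(y)$. *)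

theory Defs
  imports "HOL-Algebra.Congruence"
begin

text \<open>
  A partial binary operation is an option-valued function; its values at arguments outside the
  carrier are irrelevant.
\<close>

record 'a partial_magma = "'a partial_object" +
  pmult :: "'a \<Rightarrow> 'a \<Rightarrow> 'a option"

definition composable :: "'a partial_magma \<Rightarrow> 'a \<Rightarrow> 'a \<Rightarrow> bool" where
  "composable G g h \<longleftrightarrow> g \<in> carrier G \<and> h \<in> carrier G \<and> pmult G g h \<noteq> None"

definition gprod :: "'a partial_magma \<Rightarrow> 'a \<Rightarrow> 'a \<Rightarrow> 'a" where
  "gprod G g h = the (pmult G g h)"

definition is_identity :: "'a partial_magma \<Rightarrow> 'a \<Rightarrow> bool" where
  "is_identity G e \<longleftrightarrow> e \<in> carrier G
     \<and> (\<forall>g. composable G e g \<longrightarrow> gprod G e g = g)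
     \<and> (\<forall>g. composable G g e \<longrightarrow> gprod G g e = g)"

definition identities :: "'a partial_magma \<Rightarrow> 'a set" where
  "identities G = {e. is_identity G e}"

definition dom_id :: "'a partial_magma \<Rightarrow> 'a \<Rightarrow> 'a" where
  "dom_id G g = (THE e. is_identity G e \<and> composable G g e)"

definition ran_id :: "'a partial_magma \<Rightarrow> 'a \<Rightarrow> 'a" where
  "ran_id G g = (THE e. is_identity G e \<and> composable G e g)"

definition is_inverse :: "'a partial_magma \<Rightarrow> 'a \<Rightarrow> 'a \<Rightarrow> bool" where
  "is_inverse G g g' \<longleftrightarrow> composable G g' g \<and> composable G g g'
     \<and> dom_id G g = gprod G g' g \<and> ran_id G g = gprod G g g'"

definition ginv :: "'a partial_magma \<Rightarrow> 'a \<Rightarrow> 'a" where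
  "ginv G g = (THE g'. is_inverse G g g')"

locale groupoid =
  fixes G :: "'a partial_magma"
  assumes prod_closed: "composable G g h \<Longrightarrow> gprod G g h \<in> carrier G"
    and assoc_defined:
      "\<lbrakk>g \<in> carrier G; h \<in> carrier G; l \<in> carrier G\<rbrakk> \<Longrightarrow>
        (composable G h l \<and> composable G g (gprod G h l)) \<longleftrightarrow>
        (composable G g h \<and> composable G (gprod G g h) l)"
    and assoc:
      "\<lbrakk>composable G h l; composable G g (gprod G h l)\<rbrakk> \<Longrightarrow>
        gprod G g (gprod G h l) = gprod G (gprod G g h) l"
    and triple_defined:
      "\<lbrakk>g \<in> carrier G; h \<in> carrier G; l \<in> carrier G\<rbrakk> \<Longrightarrow>
        (composable G h l \<and> composable G g (gprod G h l)) \<longleftrightarrow>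
        (composable G g h \<and> composable G h l)"
    and ex1_dom: "g \<in> carrier G \<Longrightarrow> \<exists>!e. is_identity G e \<and> composable G g e"
    and ex1_ran: "g \<in> carrier G \<Longrightarrow> \<exists>!e. is_identity G e \<and> composable G e g"
    and ex_inverse: "g \<in> carrier G \<Longrightarrow> \<exists>g'. is_inverse G g g'"

definition isotropy_group :: "'a partial_magma \<Rightarrow> 'a \<Rightarrow> 'a set" where
  "isotropy_group G e = {g \<in> carrier G. dom_id G g = e \<and> ran_id G g = e}"

definition subgroupoid :: "'a set \<Rightarrow> 'a partial_magma \<Rightarrow> bool" where
  "subgroupoid H G \<longleftrightarrow> H \<subseteq> carrier G \<and> H \<noteq> {}
     \<and> (\<forall>h\<in>H. ginv G h \<in> H)
     \<and> (\<forall>h\<in>H. \<forall>k\<in>H. composable G h k \<longrightarrow> gprod G h k \<in> H)"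

definition conjugate_set :: "'a partial_magma \<Rightarrow> 'a set \<Rightarrow> 'a \<Rightarrow> 'a set" where
  "conjugate_set G H g =
     {gprod G (gprod G (ginv G g) h) g | h. h \<in> H \<inter> isotropy_group G (ran_id G g)}"

definition normal_subgroupoid :: "'a set \<Rightarrow> 'a partial_magma \<Rightarrow> bool" where
  "normal_subgroupoid H G \<longleftrightarrow> subgroupoid H G
     \<and> (\<forall>g\<in>carrier G. conjugate_set G H g \<noteq> {} \<and> conjugate_set G H g \<subseteq> H)"

definition left_coset :: "'a partial_magma \<Rightarrow> 'a set \<Rightarrow> 'a \<Rightarrow> 'a set" where
  "left_coset G H g = {gprod G g h | h. h \<in> H \<and> ran_id G h = dom_id G g}"

definition coset_product_rel ::
  "'a partial_magma \<Rightarrow> 'a set \<Rightarrow> 'a set \<Rightarrow> 'a set \<Rightarrow> 'a set \<Rightarrow> bool" where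
  "coset_product_rel G H A B C \<longleftrightarrow>
     (\<exists>g l. composable G g l \<and> A = left_coset G H g \<and> B = left_coset G H l
        \<and> C = left_coset G H (gprod G g l))"

text \<open>
  The product of two cosets is defined iff it is defined for some choice of representatives.
  For normal \<open>H\<close> its value does not depend on that choice, even if \<open>H\<close> contains elements with
  different domain and range (lemma \<open>pmult_quotient\<close> below). In that last case, however, the
  quotient is only a partial magma: it does not satisfy the groupoid axioms.
\<close>

definition quotient_groupoid :: "'a partial_magma \<Rightarrow> 'a set \<Rightarrow> 'a set partial_magma" where
  "quotient_groupoid G H =
     \<lparr>carrier = left_coset G H ` carrier G,
      pmult = (\<lambda>A B. if \<exists>C. coset_product_rel G H A B C
                     then Some (THE C. coset_product_rel G H A B C) else None)\<rparr>"

definition simple_groupoid :: "'a partial_magma \<Rightarrow> bool" where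
  "simple_groupoid G \<longleftrightarrow> groupoid G
     \<and> (\<forall>N. normal_subgroupoid N G \<longrightarrow> N = carrier G \<or> N = identities G)"

definition groupoid_iso :: "'a partial_magma \<Rightarrow> 'b partial_magma \<Rightarrow> ('a \<Rightarrow> 'b) \<Rightarrow> bool" where
  "groupoid_iso G K \<phi> \<longleftrightarrow> bij_betw \<phi> (carrier G) (carrier K)
     \<and> (\<forall>x y. composable G x y \<longrightarrow>
          composable K (\<phi> x) (\<phi> y) \<and> \<phi> (gprod G x y) = gprod K (\<phi> x) (\<phi> y))"

definition isomorphic_groupoids :: "'a partial_magma \<Rightarrow> 'b partial_magma \<Rightarrow> bool" where
  "isomorphic_groupoids G K \<longleftrightarrow> (\<exists>\<phi>. groupoid_iso G K \<phi>)"

abbreviation restrict_to :: "'a partial_magma \<Rightarrow> 'a set \<Rightarrow> 'a partial_magma" where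
  "restrict_to G H \<equiv> G\<lparr>carrier := H\<rparr>"

text \<open>
  A series of length \<open>n\<close> is given by its terms \<open>S 0, \<dots>, S n\<close>; the values of \<open>S\<close> beyond \<open>n\<close>
  are irrelevant.
\<close>

definition subnormal_series :: "'a partial_magma \<Rightarrow> (nat \<Rightarrow> 'a set) \<Rightarrow> nat \<Rightarrow> bool" where
  "subnormal_series G S n \<longleftrightarrow> S 0 = carrier G
     \<and> (\<forall>i\<le>n. subgroupoid (S i) G)
     \<and> (\<forall>i<n. S (Suc i) \<subseteq> S i \<and> normal_subgroupoid (S (Suc i)) (restrict_to G (S i)))"

definition series_factor :: "'a partial_magma \<Rightarrow> (nat \<Rightarrow> 'a set) \<Rightarrow> nat \<Rightarrow> 'a set partial_magma" where
  "series_factor G S i = quotient_groupoid (restrict_to G (S i)) (S (Suc i))"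

definition composition_series :: "'a partial_magma \<Rightarrow> (nat \<Rightarrow> 'a set) \<Rightarrow> nat \<Rightarrow> bool" where
  "composition_series G S n \<longleftrightarrow> subnormal_series G S n \<and> S n = identities G
     \<and> (\<forall>i<n. simple_groupoid (series_factor G S i))"

text \<open>
  Factors are counted with multiplicity, so the correspondence is one between their indices.
\<close>

definition nontrivial_indices :: "(nat \<Rightarrow> 'a set) \<Rightarrow> nat \<Rightarrow> nat set" where
  "nontrivial_indices S n = {i. i < n \<and> S i \<noteq> S (Suc i)}"

definition equivalent_series ::
  "'a partial_magma \<Rightarrow> (nat \<Rightarrow> 'a set) \<Rightarrow> nat \<Rightarrow> (nat \<Rightarrow> 'a set) \<Rightarrow> nat \<Rightarrow> bool" where
  "equivalent_series G S n T m \<longleftrightarrow>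
     (\<exists>\<pi>. bij_betw \<pi> (nontrivial_indices S n) (nontrivial_indices T m)
        \<and> (\<forall>i\<in>nontrivial_indices S n.
              isomorphic_groupoids (series_factor G S i) (series_factor G T (\<pi> i))))"

context groupoid
begin

lemma composable_carrier: "composable G g h \<Longrightarrow> g \<in> carrier G \<and> h \<in> carrier G"
  by (simp add: composable_def)

lemma dom_id: assumes "g \<in> carrier G" shows "is_identity G (dom_id G g)" "composable G g (dom_id G g)"
  using theI'[OF ex1_dom[OF assms]] unfolding dom_id_def by blast+

lemma ran_id: assumes "g \<in> carrier G" shows "is_identity G (ran_id G g)" "composable G (ran_id G g) g"
  using theI'[OF ex1_ran[OF assms]] unfolding ran_id_def by blast+

lemma dom_idI: "is_identity G e \<Longrightarrow> composable G g e \<Longrightarrow> dom_id G g = e"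
  using ex1_dom dom_id composable_carrier by metis

lemma ran_idI: "is_identity G e \<Longrightarrow> composable G e g \<Longrightarrow> ran_id G g = e"
  using ex1_ran ran_id composable_carrier by metis

lemma gprod_dom_id: "g \<in> carrier G \<Longrightarrow> gprod G g (dom_id G g) = g"
  using dom_id is_identity_def by metis

lemma gprod_ran_id: "g \<in> carrier G \<Longrightarrow> gprod G (ran_id G g) g = g"
  using ran_id is_identity_def by metis

lemma composable_triple:
  assumes "composable G g h" "composable G h l"
  shows "composable G g (gprod G h l)" "composable G (gprod G g h) l"
    "gprod G g (gprod G h l) = gprod G (gprod G g h) l"
  using assms triple_defined assoc_defined assoc composable_carrier by metis+

lemma composable_iff:
  "composable G g h \<longleftrightarrow> g \<in> carrier G \<and> h \<in> carrier G \<and> dom_id G g = ran_id G h"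
proof
  assume gh: "composable G g h"
  then have c: "g \<in> carrier G" "h \<in> carrier G" using composable_carrier by auto
  have "dom_id G g \<in> carrier G" using dom_id[OF c(1)] composable_carrier by auto
  then have "composable G (dom_id G g) h"
    using assoc_defined[of g "dom_id G g" h] dom_id[OF c(1)] gprod_dom_id[OF c(1)] gh c by auto
  then show "g \<in> carrier G \<and> h \<in> carrier G \<and> dom_id G g = ran_id G h"
    using ran_idI dom_id c by metis
next
  assume a: "g \<in> carrier G \<and> h \<in> carrier G \<and> dom_id G g = ran_id G h"
  then have "composable G g (gprod G (dom_id G g) h)"
    using composable_triple(1)[of g "dom_id G g" h] dom_id ran_id by metis
  then show "composable G g h" using a gprod_ran_id by metis
qed

lemma dom_gprod: "composable G g h \<Longrightarrow> dom_id G (gprod G g h) = dom_id G h"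
  using composable_triple(2) dom_id dom_idI composable_carrier by metis

lemma ran_gprod: "composable G g h \<Longrightarrow> ran_id G (gprod G g h) = ran_id G g"
  using composable_triple(1) ran_id ran_idI composable_carrier by metis

lemma ginv: assumes "g \<in> carrier G" shows "is_inverse G g (ginv G g)"
proof -
  have "a = b" if "is_inverse G g a" "is_inverse G g b" for a b
  proof -
    have a: "composable G a g" "gprod G a g = dom_id G g" and b: "composable G g b"
      "gprod G g b = ran_id G g" "composable G g a" "gprod G b g = dom_id G g"
      using that unfolding is_inverse_def by auto
    have "dom_id G a = ran_id G g" "ran_id G b = dom_id G g"
      using a b composable_iff by auto
    then have "gprod G a (gprod G g b) = a" "gprod G (gprod G a g) b = b"
      using a b gprod_dom_id gprod_ran_id composable_carrier by metis+
    then show ?thesis using composable_triple(3)[OF a(1) b(1)] by simp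
  qed
  then show ?thesis using ex_inverse[OF assms] theI'[of "is_inverse G g"] unfolding ginv_def by metis
qed

lemma ginv_ids: assumes "g \<in> carrier G"
  shows "ginv G g \<in> carrier G" "dom_id G (ginv G g) = ran_id G g" "ran_id G (ginv G g) = dom_id G g"
    "gprod G g (ginv G g) = ran_id G g" "gprod G (ginv G g) g = dom_id G g"
  using ginv[OF assms] unfolding is_inverse_def composable_iff by auto

lemma left_coset_eqI:
  assumes H: "subgroupoid H G" and g: "g \<in> carrier G" and h: "h \<in> H" "ran_id G h = dom_id G g"
  shows "left_coset G H (gprod G g h) = left_coset G H g"
proof -
  have hc: "h \<in> carrier G" "ginv G h \<in> H" using H h unfolding subgroupoid_def by auto
  have gh: "composable G g h" using g h hc composable_iff by simp
  show ?thesis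
  proof (intro Set.set_eqI iffI)
    fix x assume "x \<in> left_coset G H (gprod G g h)"
    then obtain k where k: "k \<in> H" "ran_id G k = dom_id G h" "x = gprod G (gprod G g h) k"
      unfolding left_coset_def using dom_gprod gh by auto
    have hk: "composable G h k" using k H hc composable_iff unfolding subgroupoid_def by auto
    then have "x = gprod G g (gprod G h k)" "gprod G h k \<in> H" "ran_id G (gprod G h k) = dom_id G g"
      using k composable_triple(3)[OF gh hk] H h ran_gprod[OF hk] unfolding subgroupoid_def by auto
    then show "x \<in> left_coset G H g" unfolding left_coset_def by auto
  next
    fix x assume "x \<in> left_coset G H g"
    then obtain k where k: "k \<in> H" "ran_id G k = dom_id G g" "x = gprod G g k"
      unfolding left_coset_def by auto
    have kc: "k \<in> carrier G" using k H unfolding subgroupoid_def by auto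
    let ?m = "gprod G (ginv G h) k"
    have ik: "composable G (ginv G h) k"
      using composable_iff ginv_ids[OF hc(1)] kc k h by simp
    have m: "?m \<in> H" "ran_id G ?m = dom_id G h"
      using ik H hc k ran_gprod[OF ik] ginv_ids[OF hc(1)] unfolding subgroupoid_def by auto
    have hm: "composable G h ?m" "gprod G h ?m = k"
      using composable_triple[OF _ ik, of h] composable_iff ginv_ids[OF hc(1)] hc kc k h
        gprod_ran_id[OF kc] by auto
    then have "x = gprod G (gprod G g h) ?m"
      using composable_triple(3)[OF gh hm(1)] k by simp
    then show "x \<in> left_coset G H (gprod G g h)"
      unfolding left_coset_def using m dom_gprod[OF gh] by auto
  qed
qed

lemma identity_mem:
  assumes H: "normal_subgroupoid H G" and g: "g \<in> carrier G"
  shows "ran_id G g \<in> H"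
proof -
  obtain h where h: "h \<in> H" "h \<in> isotropy_group G (ran_id G g)"
    using H g unfolding normal_subgroupoid_def conjugate_set_def by blast
  have hc: "h \<in> carrier G" using h unfolding isotropy_group_def by auto
  have "ginv G h \<in> H" using H h unfolding normal_subgroupoid_def subgroupoid_def by auto
  moreover have "composable G h (ginv G h)" using composable_iff ginv_ids[OF hc] hc by auto
  ultimately have "gprod G h (ginv G h) \<in> H"
    using H h unfolding normal_subgroupoid_def subgroupoid_def by auto
  then show ?thesis using ginv_ids[OF hc] h unfolding isotropy_group_def by auto
qed

lemma self_ids: assumes "g \<in> carrier G"
  shows "ran_id G (dom_id G g) = dom_id G g" "ran_id G (ran_id G g) = ran_id G g"
    "dom_id G (dom_id G g) = dom_id G g"
  using dom_id[OF assms] ran_id[OF assms] dom_gprod[OF dom_id(2)[OF assms]]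
    ran_gprod[OF ran_id(2)[OF assms]] gprod_dom_id[OF assms] gprod_ran_id[OF assms]
  unfolding composable_iff by simp_all

lemma left_coset_eqD:
  assumes H: "normal_subgroupoid H G" and g: "g \<in> carrier G"
    and eq: "left_coset G H g' = left_coset G H g" and g': "g' \<in> carrier G"
  obtains h where "h \<in> H" "ran_id G h = dom_id G g" "g' = gprod G g h"
proof -
  have "dom_id G g' = ran_id G (ginv G g')" using ginv_ids[OF g'] by simp
  then have "dom_id G g' \<in> H" using identity_mem[OF H ginv_ids(1)[OF g']] by simp
  then have "g' \<in> left_coset G H g'"
    unfolding left_coset_def using self_ids[OF g'] gprod_dom_id[OF g'] by force
  then show ?thesis using that eq unfolding left_coset_def by auto
qed

lemma coset_product_unique:
  assumes H: "normal_subgroupoid H G" and gl: "composable G g l" and gl': "composable G g' l'"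
    and eq: "left_coset G H g' = left_coset G H g" "left_coset G H l' = left_coset G H l"
  shows "left_coset G H (gprod G g' l') = left_coset G H (gprod G g l)"
proof -
  have sub: "subgroupoid H G" using H unfolding normal_subgroupoid_def by auto
  have c: "g \<in> carrier G" "l \<in> carrier G" "g' \<in> carrier G" "l' \<in> carrier G"
    using gl gl' composable_carrier by auto
  obtain h where h: "h \<in> H" "ran_id G h = dom_id G g" "g' = gprod G g h"
    using left_coset_eqD[OF H c(1) eq(1) c(3)] .
  obtain k where k: "k \<in> H" "ran_id G k = dom_id G l" "l' = gprod G l k"
    using left_coset_eqD[OF H c(2) eq(2) c(4)] .
  have hc: "h \<in> carrier G" "k \<in> carrier G" using h k sub unfolding subgroupoid_def by auto
  have gh: "composable G g h" and lk: "composable G l k" using c hc h k composable_iff by auto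
  have dh: "dom_id G h = ran_id G l"
    using gl' dom_gprod[OF gh] ran_gprod[OF lk] h k unfolding composable_iff by auto
  have rh: "ran_id G h = ran_id G l" using gl h unfolding composable_iff by auto
  have iso: "h \<in> H \<inter> isotropy_group G (ran_id G l)"
    using h hc dh rh unfolding isotropy_group_def by auto
  define w where "w = gprod G (gprod G (ginv G l) h) l"
  have "w \<in> conjugate_set G H l" unfolding conjugate_set_def w_def using iso by blast
  then have w: "w \<in> H" using H c unfolding normal_subgroupoid_def by auto
  have hl: "composable G h l" using hc c dh composable_iff by auto
  have ih: "composable G (ginv G l) h" using ginv_ids[OF c(2)] hc rh composable_iff by auto
  have li: "composable G l (ginv G l)" using ginv_ids[OF c(2)] c composable_iff by auto
  have w2: "w = gprod G (ginv G l) (gprod G h l)"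
    unfolding w_def using composable_triple(3)[OF ih hl] by simp
  have ihl: "composable G (ginv G l) (gprod G h l)" using composable_triple(1)[OF ih hl] .
  have "gprod G l w = gprod G (ran_id G l) (gprod G h l)"
    unfolding w2 using composable_triple(3)[OF li ihl] ginv_ids[OF c(2)] by simp
  also have "\<dots> = gprod G h l"
    using gprod_ran_id[OF prod_closed[OF hl]] ran_gprod[OF hl] rh by simp
  finally have lw: "gprod G l w = gprod G h l" .
  have clw: "composable G l w" unfolding w2 using composable_triple(1)[OF li ihl] .
  have dw: "dom_id G w = dom_id G l" unfolding w2 using dom_gprod[OF ihl] dom_gprod[OF hl] by simp
  have wk: "composable G w k" using dw k hc clw composable_iff by auto
  have "gprod G g' l' = gprod G g (gprod G h (gprod G l k))"
    using h k composable_triple(3)[OF gh, of l'] composable_triple(1)[OF hl lk] by simp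
  also have "\<dots> = gprod G g (gprod G (gprod G l w) k)"
    using composable_triple(3)[OF hl lk] lw by simp
  also have "\<dots> = gprod G g (gprod G l (gprod G w k))"
    using composable_triple(3)[OF clw wk] by simp
  also have "\<dots> = gprod G (gprod G g l) (gprod G w k)"
    using composable_triple(3)[OF gl composable_triple(1)[OF clw wk]] .
  finally have "gprod G g' l' = gprod G (gprod G g l) (gprod G w k)" .
  moreover have "gprod G w k \<in> H" using w k wk sub unfolding subgroupoid_def by auto
  moreover have "ran_id G (gprod G w k) = dom_id G (gprod G g l)"
    using ran_gprod[OF wk] dom_gprod[OF gl] clw unfolding composable_iff by auto
  ultimately show ?thesis using left_coset_eqI[OF sub prod_closed[OF gl]] by simp
qed

lemma pmult_quotient:
  assumes H: "normal_subgroupoid H G" and gl: "composable G g l"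
  shows "pmult (quotient_groupoid G H) (left_coset G H g) (left_coset G H l)
    = Some (left_coset G H (gprod G g l))"
proof -
  let ?P = "coset_product_rel G H (left_coset G H g) (left_coset G H l)"
  have ex: "?P (left_coset G H (gprod G g l))" unfolding coset_product_rel_def using gl by blast
  moreover have "C = left_coset G H (gprod G g l)" if "?P C" for C
    using that coset_product_unique[OF H gl] unfolding coset_product_rel_def by metis
  ultimately have "(THE C. ?P C) = left_coset G H (gprod G g l)" by (rule the_equality)
  then show ?thesis unfolding quotient_groupoid_def using ex by auto
qed

end

end

theory Submission
  imports Defs
begin

text \<open>
  Let \<open>S\<close> and \<open>T\<close> be two composition series. Call an index \<open>i\<close> of \<open>S\<close> linked to an index \<open>j\<close> of
  \<open>T\<close> if the intersection \<open>S i \<inter> T j\<close> still meets every coset of \<open>S (i + 1)\<close> in \<open>S i\<close>, whereas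
  \<open>S i \<inter> T (j + 1)\<close> is already contained in \<open>S (i + 1)\<close>. Along the chain \<open>T\<close> the image of
  \<open>S i \<inter> T j\<close> in the factor \<open>S i / S (i + 1)\<close> shrinks from everything to the identities. As long
  as this image is everything, the next image is a normal subgroupoid of the factor, so by
  simplicity it is everything or trivial: the image drops in a single step, and every nontrivial
  \<open>i\<close> is linked to some \<open>j\<close> (\<open>linked_exists\<close>). Comparing elements shows that linkage is functional
  (\<open>linked_unique\<close>) and symmetric in \<open>S\<close> and \<open>T\<close> (\<open>linked_sym\<close>); hence it is a bijection between
  the nontrivial indices. If \<open>i\<close> and \<open>j\<close> are linked in both directions, two elements of
  \<open>S i \<inter> T j\<close> are congruent modulo \<open>S (i + 1)\<close> iff they are congruent modulo \<open>T (j + 1)\<close>, so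
  \<open>x S (i + 1) \<mapsto> x T (j + 1)\<close>, for \<open>x\<close> in \<open>S i \<inter> T j\<close>, is an isomorphism of the factors
  (\<open>isomorphic_quotients\<close>).

  What distinguishes groupoids from groups is that a normal subgroupoid may contain elements whose
  domain and range differ; composability of cosets then depends on the representatives. A quotient by
  such a subgroupoid is never a groupoid (\<open>isotropic_of_groupoid_quotient\<close>), and simple factors are
  groupoids by definition, so in a composition series every term but the first is a bundle of groups.
\<close>

section \<open>Subgroupoids and restriction\<close>

context groupoid
begin

lemma ginv_eqI:
  assumes "composable G h g" "gprod G h g = dom_id G g"
  shows "ginv G g = h"
proof -
  have g: "g \<in> carrier G" and h: "h \<in> carrier G" and d: "dom_id G h = ran_id G g"
    using assms composable_iff by auto
  have gi: "composable G g (ginv G g)" using g ginv_ids[OF g] composable_iff by auto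
  have rh: "ran_id G h = dom_id G g"
    using ran_gprod[OF assms(1)] assms(2) self_ids[OF g] by simp
  have "h = gprod G h (gprod G g (ginv G g))"
    using ginv_ids[OF g] gprod_dom_id[OF h] d by simp
  also have "\<dots> = gprod G (dom_id G g) (ginv G g)"
    using composable_triple(3)[OF assms(1) gi] assms(2) by simp
  also have "\<dots> = ginv G g" using gprod_ran_id[OF ginv_ids(1)[OF g]] ginv_ids[OF g] by simp
  finally show ?thesis ..
qed

lemma identity_self:
  assumes "is_identity G e"
  shows "e \<in> carrier G" "dom_id G e = e" "ran_id G e = e"
proof -
  show e: "e \<in> carrier G" using assms unfolding is_identity_def by simp
  have "gprod G e (dom_id G e) = dom_id G e" "gprod G (ran_id G e) e = ran_id G e"
    using assms dom_id[OF e] ran_id[OF e] unfolding is_identity_def by auto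
  then show "dom_id G e = e" "ran_id G e = e" using gprod_dom_id[OF e] gprod_ran_id[OF e] by simp_all
qed

lemma idempotent_identity:
  assumes "composable G e e" "gprod G e e = e"
  shows "is_identity G e"
proof -
  have e: "e \<in> carrier G" and d: "dom_id G e = ran_id G e" using assms composable_iff by auto
  have ei: "composable G e (ginv G e)" using e ginv_ids[OF e] composable_iff by auto
  have "ran_id G e = gprod G e (gprod G e (ginv G e))"
    using composable_triple(3)[OF assms(1) ei] assms(2) ginv_ids[OF e] by simp
  also have "\<dots> = e" using ginv_ids[OF e] gprod_dom_id[OF e] d by simp
  finally show ?thesis using ran_id[OF e] by simp
qed

lemma subgroupoidD:
  assumes "subgroupoid H G"
  shows "\<And>h. h \<in> H \<Longrightarrow> h \<in> carrier G" "\<And>h. h \<in> H \<Longrightarrow> ginv G h \<in> H"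
    "\<And>h k. h \<in> H \<Longrightarrow> k \<in> H \<Longrightarrow> dom_id G h = ran_id G k \<Longrightarrow> gprod G h k \<in> H"
    "\<And>h. h \<in> H \<Longrightarrow> dom_id G h \<in> H" "\<And>h. h \<in> H \<Longrightarrow> ran_id G h \<in> H"
proof -
  show c: "\<And>h. h \<in> H \<Longrightarrow> h \<in> carrier G" and i: "\<And>h. h \<in> H \<Longrightarrow> ginv G h \<in> H"
    using assms unfolding subgroupoid_def by auto
  show p: "\<And>h k. h \<in> H \<Longrightarrow> k \<in> H \<Longrightarrow> dom_id G h = ran_id G k \<Longrightarrow> gprod G h k \<in> H"
    using assms composable_iff unfolding subgroupoid_def by (meson subsetD)
  show "\<And>h. h \<in> H \<Longrightarrow> dom_id G h \<in> H" "\<And>h. h \<in> H \<Longrightarrow> ran_id G h \<in> H"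
    using p i ginv_ids c by metis+
qed

lemma subgroupoidI:
  assumes "H \<subseteq> carrier G" "H \<noteq> {}" "\<And>h. h \<in> H \<Longrightarrow> ginv G h \<in> H"
    "\<And>h k. h \<in> H \<Longrightarrow> k \<in> H \<Longrightarrow> dom_id G h = ran_id G k \<Longrightarrow> gprod G h k \<in> H"
  shows "subgroupoid H G"
  using assms composable_iff unfolding subgroupoid_def by blast

lemma subgroupoid_Int:
  assumes "subgroupoid H G" "subgroupoid K G" "H \<inter> K \<noteq> {}"
  shows "subgroupoid (H \<inter> K) G"
  using assms unfolding subgroupoid_def by blast

lemma normal_subgroupoid_iff:
  "normal_subgroupoid N G \<longleftrightarrow> subgroupoid N G \<and> (\<forall>g\<in>carrier G. ran_id G g \<in> N) \<and>
     (\<forall>g\<in>carrier G. \<forall>h\<in>N. dom_id G h = ran_id G g \<longrightarrow> ran_id G h = ran_id G g \<longrightarrow>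
        gprod G (gprod G (ginv G g) h) g \<in> N)"
proof
  assume N: "normal_subgroupoid N G"
  then have sub: "subgroupoid N G" unfolding normal_subgroupoid_def by simp
  have "gprod G (gprod G (ginv G g) h) g \<in> N"
    if "g \<in> carrier G" "h \<in> N" "dom_id G h = ran_id G g" "ran_id G h = ran_id G g" for g h
  proof -
    have "gprod G (gprod G (ginv G g) h) g \<in> conjugate_set G N g"
      unfolding conjugate_set_def isotropy_group_def using that subgroupoidD(1)[OF sub] by blast
    then show ?thesis using N that unfolding normal_subgroupoid_def by blast
  qed
  then show "subgroupoid N G \<and> (\<forall>g\<in>carrier G. ran_id G g \<in> N) \<and>
     (\<forall>g\<in>carrier G. \<forall>h\<in>N. dom_id G h = ran_id G g \<longrightarrow> ran_id G h = ran_id G g \<longrightarrow>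
        gprod G (gprod G (ginv G g) h) g \<in> N)"
    using sub identity_mem[OF N] by blast
next
  assume N: "subgroupoid N G \<and> (\<forall>g\<in>carrier G. ran_id G g \<in> N) \<and>
     (\<forall>g\<in>carrier G. \<forall>h\<in>N. dom_id G h = ran_id G g \<longrightarrow> ran_id G h = ran_id G g \<longrightarrow>
        gprod G (gprod G (ginv G g) h) g \<in> N)"
  have "conjugate_set G N g \<noteq> {}" if g: "g \<in> carrier G" for g
  proof -
    have "ran_id G g \<in> N \<inter> isotropy_group G (ran_id G g)"
      using N g identity_self[OF ran_id(1)[OF g]] unfolding isotropy_group_def by auto
    then show ?thesis unfolding conjugate_set_def by blast
  qed
  then show "normal_subgroupoid N G"
    using N unfolding normal_subgroupoid_def conjugate_set_def isotropy_group_def by auto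
qed

lemma composable_restrict:
  "H \<subseteq> carrier G \<Longrightarrow>
     composable (restrict_to G H) g h \<longleftrightarrow> g \<in> H \<and> h \<in> H \<and> dom_id G g = ran_id G h"
  using composable_iff[of g h] unfolding composable_def by auto

lemma gprod_restrict: "gprod (restrict_to G H) = gprod G"
  unfolding gprod_def by (simp add: fun_eq_iff)

lemma is_identity_restrict:
  assumes H: "subgroupoid H G"
  shows "is_identity (restrict_to G H) e \<longleftrightarrow> e \<in> H \<and> is_identity G e"
proof
  have HG: "H \<subseteq> carrier G" using H unfolding subgroupoid_def by simp
  assume e: "is_identity (restrict_to G H) e"
  then have eH: "e \<in> H" unfolding is_identity_def by simp
  then have ec: "e \<in> carrier G" using HG by auto
  have "gprod G e (dom_id G e) = dom_id G e"
    using e eH subgroupoidD(4)[OF H eH] self_ids[OF ec]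
    unfolding is_identity_def composable_restrict[OF HG] gprod_restrict by simp
  then show "e \<in> H \<and> is_identity G e" using eH gprod_dom_id[OF ec] dom_id[OF ec] by simp
next
  have HG: "H \<subseteq> carrier G" using H unfolding subgroupoid_def by simp
  assume "e \<in> H \<and> is_identity G e"
  then show "is_identity (restrict_to G H) e"
    using HG composable_iff
    unfolding is_identity_def composable_restrict[OF HG] gprod_restrict by auto
qed

lemma dom_id_restrict:
  assumes H: "subgroupoid H G" and h: "h \<in> H"
  shows "dom_id (restrict_to G H) h = dom_id G h" "ran_id (restrict_to G H) h = ran_id G h"
    "\<exists>!e. is_identity (restrict_to G H) e \<and> composable (restrict_to G H) h e"
    "\<exists>!e. is_identity (restrict_to G H) e \<and> composable (restrict_to G H) e h"
proof -
  have HG: "H \<subseteq> carrier G" using H unfolding subgroupoid_def by simp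
  have hc: "h \<in> carrier G" using h HG by auto
  have d: "is_identity (restrict_to G H) e \<and> composable (restrict_to G H) h e \<longleftrightarrow> e = dom_id G h"
    and r: "is_identity (restrict_to G H) e \<and> composable (restrict_to G H) e h \<longleftrightarrow> e = ran_id G h" for e
    using subgroupoidD(4,5)[OF H h] h dom_id(1)[OF hc] ran_id(1)[OF hc] identity_self
      is_identity_restrict[OF H, of e] composable_restrict[OF HG] by metis+
  show "dom_id (restrict_to G H) h = dom_id G h" "ran_id (restrict_to G H) h = ran_id G h"
    "\<exists>!e. is_identity (restrict_to G H) e \<and> composable (restrict_to G H) h e"
    "\<exists>!e. is_identity (restrict_to G H) e \<and> composable (restrict_to G H) e h"
    unfolding dom_id_def[of "restrict_to G H"] ran_id_def[of "restrict_to G H"] d r by simp_all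
qed

lemma groupoid_restrict:
  assumes H: "subgroupoid H G"
  shows "groupoid (restrict_to G H)"
proof -
  have HG: "H \<subseteq> carrier G" using H unfolding subgroupoid_def by simp
  note cr = composable_restrict[OF HG] and gr = gprod_restrict and D = subgroupoidD[OF H]
  have dg: "dom_id G (gprod G g h) = dom_id G h" and rg: "ran_id G (gprod G g h) = ran_id G g"
    if "g \<in> H" "h \<in> H" "dom_id G g = ran_id G h" for g h
    using dom_gprod ran_gprod composable_iff D that by auto
  show ?thesis
  proof
    show "gprod (restrict_to G H) g h \<in> carrier (restrict_to G H)"
      if "composable (restrict_to G H) g h" for g h
      using that D unfolding cr gr by simp
    show "(composable (restrict_to G H) h l \<and> composable (restrict_to G H) g (gprod (restrict_to G H) h l)) \<longleftrightarrow>
        (composable (restrict_to G H) g h \<and> composable (restrict_to G H) (gprod (restrict_to G H) g h) l)"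
      if "g \<in> carrier (restrict_to G H)" "h \<in> carrier (restrict_to G H)" "l \<in> carrier (restrict_to G H)" for g h l
      using that D dg rg unfolding cr gr by auto
    show "gprod (restrict_to G H) g (gprod (restrict_to G H) h l) = gprod (restrict_to G H) (gprod (restrict_to G H) g h) l"
      if "composable (restrict_to G H) h l" "composable (restrict_to G H) g (gprod (restrict_to G H) h l)" for g h l
      using that D rg composable_iff composable_triple(3)[of g h l] unfolding cr gr by auto
    show "(composable (restrict_to G H) h l \<and> composable (restrict_to G H) g (gprod (restrict_to G H) h l)) \<longleftrightarrow>
        (composable (restrict_to G H) g h \<and> composable (restrict_to G H) h l)"
      if "g \<in> carrier (restrict_to G H)" "h \<in> carrier (restrict_to G H)" "l \<in> carrier (restrict_to G H)" for g h l
      using that D dg rg unfolding cr gr by auto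
    show "\<exists>!e. is_identity (restrict_to G H) e \<and> composable (restrict_to G H) g e"
      "\<exists>!e. is_identity (restrict_to G H) e \<and> composable (restrict_to G H) e g"
      if "g \<in> carrier (restrict_to G H)" for g
      using dom_id_restrict(3,4)[OF H] that by simp_all
    show "\<exists>g'. is_inverse (restrict_to G H) g g'" if "g \<in> carrier (restrict_to G H)" for g
    proof -
      have g: "g \<in> H" using that by simp
      then have "is_inverse (restrict_to G H) g (ginv G g)"
        unfolding is_inverse_def cr gr using D ginv_ids dom_id_restrict[OF H] by auto
      then show ?thesis by blast
    qed
  qed
qed

lemma ginv_restrict:
  assumes H: "subgroupoid H G" and h: "h \<in> H"
  shows "ginv (restrict_to G H) h = ginv G h"
proof (rule groupoid.ginv_eqI[OF groupoid_restrict[OF H]])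
  have HG: "H \<subseteq> carrier G" using H unfolding subgroupoid_def by simp
  show "composable (restrict_to G H) (ginv G h) h"
    "gprod (restrict_to G H) (ginv G h) h = dom_id (restrict_to G H) h"
    using composable_restrict[OF HG] gprod_restrict subgroupoidD[OF H] h ginv_ids
      dom_id_restrict[OF H h] by auto
qed

lemma subgroupoid_restrict:
  assumes H: "subgroupoid H G"
  shows "subgroupoid K (restrict_to G H) \<longleftrightarrow> subgroupoid K G \<and> K \<subseteq> H"
proof -
  have HG: "H \<subseteq> carrier G" using H unfolding subgroupoid_def by simp
  have "K \<subseteq> H \<Longrightarrow> ?thesis"
    using HG ginv_restrict[OF H] composable_iff
    unfolding subgroupoid_def composable_restrict[OF HG] gprod_restrict by (simp add: subset_iff)
  then show ?thesis unfolding subgroupoid_def by auto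
qed

lemma normal_restrict_iff:
  assumes H: "subgroupoid H G"
  shows "normal_subgroupoid N (restrict_to G H) \<longleftrightarrow> subgroupoid N G \<and> N \<subseteq> H \<and>
     (\<forall>g\<in>H. ran_id G g \<in> N) \<and>
     (\<forall>g\<in>H. \<forall>h\<in>N. dom_id G h = ran_id G g \<longrightarrow> ran_id G h = ran_id G g \<longrightarrow>
        gprod G (gprod G (ginv G g) h) g \<in> N)"
  unfolding groupoid.normal_subgroupoid_iff[OF groupoid_restrict[OF H]] subgroupoid_restrict[OF H]
    gprod_restrict
  using dom_id_restrict[OF H] ginv_restrict[OF H] by (auto simp: subset_iff)

lemma normal_restrict_Int:
  assumes H: "subgroupoid H G" and K: "subgroupoid K G" and ne: "H \<inter> K \<noteq> {}"
    and N: "normal_subgroupoid N (restrict_to G K)"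
  shows "normal_subgroupoid (H \<inter> N) (restrict_to G (H \<inter> K))"
proof -
  note HK = subgroupoid_Int[OF H K ne]
  note N' = N[unfolded normal_restrict_iff[OF K]]
  obtain x where "x \<in> H \<inter> K" using ne by auto
  then have "ran_id G x \<in> H \<inter> N" using subgroupoidD(5)[OF H] N' by auto
  then have "subgroupoid (H \<inter> N) G" using subgroupoid_Int[OF H] N' by auto
  moreover have "gprod G (gprod G (ginv G g) h) g \<in> H"
    if "g \<in> H" "h \<in> H" "dom_id G h = ran_id G g" "ran_id G h = ran_id G g" for g h
  proof -
    have c: "g \<in> carrier G" "h \<in> carrier G" using subgroupoidD(1)[OF H] that by auto
    have "composable G (ginv G g) h" using ginv_ids[OF c(1)] c that composable_iff by auto
    then show ?thesis using subgroupoidD[OF H] that ginv_ids[OF c(1)] dom_gprod by metis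
  qed
  ultimately show ?thesis
    unfolding normal_restrict_iff[OF HK] using N' subgroupoidD(5)[OF H] by auto
qed

lemma left_coset_restrict:
  assumes H: "subgroupoid H G" and "N \<subseteq> H" "g \<in> H"
  shows "left_coset (restrict_to G H) N g = left_coset G N g"
proof -
  have "h \<in> N \<and> ran_id (restrict_to G H) h = dom_id (restrict_to G H) g \<longleftrightarrow>
      h \<in> N \<and> ran_id G h = dom_id G g" for h
    using dom_id_restrict[OF H] assms by auto
  then show ?thesis unfolding left_coset_def gprod_restrict by auto
qed

text \<open>The hypothesis \<open>dom_id G g \<in> N\<close> puts \<open>g\<close> into its own coset.\<close>

lemma left_coset_eq_iff:
  assumes N: "subgroupoid N G" and g: "g \<in> carrier G" "dom_id G g \<in> N" and l: "l \<in> carrier G"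
  shows "left_coset G N g = left_coset G N l \<longleftrightarrow>
     ran_id G g = ran_id G l \<and> gprod G (ginv G l) g \<in> N"
proof
  assume eq: "left_coset G N g = left_coset G N l"
  have "g \<in> left_coset G N g"
    unfolding left_coset_def using g(2) self_ids[OF g(1)] gprod_dom_id[OF g(1)] by force
  then obtain h where h: "h \<in> N" "ran_id G h = dom_id G l" "g = gprod G l h"
    using eq unfolding left_coset_def by auto
  have hc: "h \<in> carrier G" using subgroupoidD(1)[OF N] h by auto
  have lh: "composable G l h" using composable_iff l h hc by auto
  have "composable G (ginv G l) l" using composable_iff l ginv_ids[OF l] by auto
  from composable_triple(3)[OF this lh] have "gprod G (ginv G l) g = h"
    using h ginv_ids[OF l] gprod_ran_id[OF hc] by simp
  then show "ran_id G g = ran_id G l \<and> gprod G (ginv G l) g \<in> N" using h ran_gprod[OF lh] by simp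
next
  assume a: "ran_id G g = ran_id G l \<and> gprod G (ginv G l) g \<in> N"
  have ig: "composable G (ginv G l) g" and li: "composable G l (ginv G l)"
    using composable_iff a g l ginv_ids[OF l] by auto
  have "gprod G l (gprod G (ginv G l) g) = g"
    using composable_triple(3)[OF li ig] ginv_ids[OF l] a gprod_ran_id[OF g(1)] by simp
  then show "left_coset G N g = left_coset G N l"
    using left_coset_eqI[OF N l, of "gprod G (ginv G l) g"] a ran_gprod[OF ig] ginv_ids[OF l] by simp
qed

lemma gprod_ginv_cancel:
  assumes "g \<in> carrier G" "l \<in> carrier G" "ran_id G g = ran_id G l"
  shows "gprod G l (gprod G (ginv G l) g) = g"
proof -
  have "composable G l (ginv G l)" "composable G (ginv G l) g"
    using composable_iff assms ginv_ids by auto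
  from composable_triple(3)[OF this] show ?thesis using assms ginv_ids gprod_ran_id[OF assms(1)] by simp
qed

text \<open>
  Here \<open>g = l (l\<^sup>-\<^sup>1 g)\<close> is a product of two elements of \<open>K\<close>. The cases of interest are \<open>K = N\<close> and,
  when two series are compared, \<open>N\<close> a term of one series and \<open>K\<close> a term of the other.
\<close>

lemma mem_of_left_coset_eq:
  assumes N: "subgroupoid N G" and K: "subgroupoid K G"
    and g: "g \<in> carrier G" "dom_id G g \<in> N" and l: "l \<in> K"
    and eq: "left_coset G N g = left_coset G N l" and m: "gprod G (ginv G l) g \<in> K"
  shows "g \<in> K"
proof -
  have lc: "l \<in> carrier G" using subgroupoidD(1)[OF K l] .
  have r: "ran_id G g = ran_id G l" using left_coset_eq_iff[OF N g lc] eq by simp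
  have "composable G (ginv G l) g" using composable_iff g lc r ginv_ids[OF lc] by simp
  then have "ran_id G (gprod G (ginv G l) g) = dom_id G l" using ran_gprod ginv_ids[OF lc] by simp
  then show ?thesis using subgroupoidD(3)[OF K l m] gprod_ginv_cancel[OF g(1) lc r] by simp
qed

section \<open>Quotients that are groupoids\<close>

lemma composable_quotient:
  assumes N: "normal_subgroupoid N G"
  shows "composable (quotient_groupoid G N) A B \<longleftrightarrow>
     (\<exists>g l. composable G g l \<and> A = left_coset G N g \<and> B = left_coset G N l)"
  using pmult_quotient[OF N] composable_carrier
  unfolding composable_def[of "quotient_groupoid G N"]
  by (auto simp: quotient_groupoid_def coset_product_rel_def split: if_splits)

lemma gprod_quotient:
  assumes "normal_subgroupoid N G" "composable G g l"
  shows "gprod (quotient_groupoid G N) (left_coset G N g) (left_coset G N l) = left_coset G N (gprod G g l)"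
  using pmult_quotient[OF assms] unfolding gprod_def by simp

end

locale groupoid_quotient = groupoid G for G :: "'a partial_magma" +
  fixes N
  assumes normal: "normal_subgroupoid N G"
    and groupoid_quot: "groupoid (quotient_groupoid G N)"
begin

abbreviation "Q \<equiv> quotient_groupoid G N"
abbreviation "coset \<equiv> left_coset G N"

sublocale quot: groupoid Q by (fact groupoid_quot)

lemma subgroupoid_normal: "subgroupoid N G"
  using normal unfolding normal_subgroupoid_def by simp

lemma dom_mem_normal: "g \<in> carrier G \<Longrightarrow> dom_id G g \<in> N"
  using identity_mem[OF normal ginv_ids(1)] ginv_ids by simp

lemma carrier_quotient: "carrier Q = coset ` carrier G"
  unfolding quotient_groupoid_def by simp

text \<open>In a groupoid the identities are the idempotents, and cosets of idempotents are idempotent.\<close>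

lemma identity_coset:
  assumes e: "is_identity G e"
  shows "is_identity Q (coset e)"
proof (rule quot.idempotent_identity)
  have c: "composable G e e" "gprod G e e = e"
    using composable_iff identity_self[OF e] gprod_dom_id[of e] by auto
  show "composable Q (coset e) (coset e)" using composable_quotient[OF normal] c by blast
  show "gprod Q (coset e) (coset e) = coset e" using gprod_quotient[OF normal c(1)] c by simp
qed

text \<open>
  An element \<open>h\<close> of \<open>N\<close> lies in the coset of the identity \<open>ran_id G h\<close> and is composable with
  \<open>dom_id G h\<close>. The cosets of these two identities are therefore composable; but both are identities
  of the quotient, and in a groupoid only equal identities are composable.
\<close>

lemma isotropic_of_groupoid_quotient:
  assumes h: "h \<in> N"
  shows "dom_id G h = ran_id G h"
proof -
  have hc: "h \<in> carrier G" using subgroupoidD(1)[OF subgroupoid_normal h] .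
  define e where "e = dom_id G h"
  define f where "f = ran_id G h"
  have e: "is_identity G e" "composable G h e" and f: "is_identity G f" "composable G f h"
    using dom_id[OF hc] ran_id[OF hc] unfolding e_def f_def by simp_all
  have ec: "e \<in> carrier G" "ran_id G e = e" and fc: "f \<in> carrier G" "dom_id G f = f" "ran_id G f = f"
    using identity_self e f by blast+
  have "coset h = coset f"
    using left_coset_eqI[OF subgroupoid_normal fc(1) h] fc gprod_ran_id[OF hc] unfolding f_def by simp
  then have "composable Q (coset f) (coset e)" using composable_quotient[OF normal] e(2) by metis
  then have "coset f = coset e"
    using identity_coset[OF e(1)] identity_coset[OF f(1)] unfolding is_identity_def by metis
  then have "ran_id G f = ran_id G e"
    using left_coset_eq_iff[OF subgroupoid_normal fc(1) dom_mem_normal[OF fc(1)] ec(1)] by simp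
  then show ?thesis using ec fc unfolding e_def f_def by simp
qed

lemma coset_eq_iff:
  assumes "g \<in> carrier G" "l \<in> carrier G"
  shows "coset g = coset l \<longleftrightarrow> ran_id G g = ran_id G l \<and> gprod G (ginv G l) g \<in> N"
  using left_coset_eq_iff[OF subgroupoid_normal assms(1) dom_mem_normal[OF assms(1)] assms(2)] .

lemma coset_eqD:
  assumes g: "g \<in> carrier G" and l: "l \<in> carrier G" and eq: "coset g = coset l"
  shows "dom_id G g = dom_id G l" "ran_id G g = ran_id G l"
proof -
  note r = eq[unfolded coset_eq_iff[OF g l]]
  then show "ran_id G g = ran_id G l" by simp
  have "composable G (ginv G l) g" using composable_iff g l ginv_ids[OF l] r by simp
  then show "dom_id G g = dom_id G l"
    using isotropic_of_groupoid_quotient[of "gprod G (ginv G l) g"] r dom_gprod ran_gprod ginv_ids[OF l]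
    by simp
qed

lemma composable_cosets:
  assumes g: "g \<in> carrier G" and l: "l \<in> carrier G"
  shows "composable Q (coset g) (coset l) \<longleftrightarrow> composable G g l"
  using composable_quotient[OF normal, of "coset g" "coset l"] coset_eqD g l composable_iff by metis

lemma dom_coset: "g \<in> carrier G \<Longrightarrow> dom_id Q (coset g) = coset (dom_id G g)"
  using quot.dom_idI[OF identity_coset] dom_id composable_quotient[OF normal] by metis

lemma ran_coset: "g \<in> carrier G \<Longrightarrow> ran_id Q (coset g) = coset (ran_id G g)"
  using quot.ran_idI[OF identity_coset] ran_id composable_quotient[OF normal] by metis

lemma ginv_coset:
  assumes g: "g \<in> carrier G"
  shows "ginv Q (coset g) = coset (ginv G g)"
proof (rule quot.ginv_eqI)
  have c: "composable G (ginv G g) g" using composable_iff ginv_ids[OF g] g by simp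
  show "composable Q (coset (ginv G g)) (coset g)" using composable_quotient[OF normal] c by blast
  show "gprod Q (coset (ginv G g)) (coset g) = dom_id Q (coset g)"
    using gprod_quotient[OF normal c] dom_coset[OF g] ginv_ids[OF g] by simp
qed

lemma image_subset_identities_iff:
  assumes M: "subgroupoid M G"
  shows "coset ` M \<subseteq> identities Q \<longleftrightarrow> M \<subseteq> N"
proof
  assume id: "coset ` M \<subseteq> identities Q"
  show "M \<subseteq> N"
  proof
    fix x assume x: "x \<in> M"
    then have xc: "x \<in> carrier G" using subgroupoidD(1)[OF M] by simp
    then have dx: "dom_id G x \<in> carrier G" "dom_id G x \<in> N"
      using dom_mem_normal composable_carrier dom_id(2) by auto
    have "is_identity Q (coset x)" using id x unfolding identities_def by auto
    then have eq: "coset x = coset (dom_id G x)"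
      using quot.identity_self(2) dom_coset[OF xc] by simp
    have "gprod G (ginv G (dom_id G x)) x \<in> N" using eq coset_eq_iff[OF xc dx(1)] by simp
    then show "x \<in> N"
      using mem_of_left_coset_eq[OF subgroupoid_normal subgroupoid_normal xc _ dx(2) eq] dx by simp
  qed
next
  assume MN: "M \<subseteq> N"
  have "is_identity Q (coset x)" if "x \<in> M" for x
  proof -
    have xN: "x \<in> N" and xc: "x \<in> carrier G" using that MN subgroupoidD(1)[OF M] by auto
    have "coset x = coset (ran_id G x)"
      using left_coset_eqI[OF subgroupoid_normal _ xN, of "ran_id G x"] composable_carrier
        ran_id[OF xc] identity_self[OF ran_id(1)[OF xc]] gprod_ran_id[OF xc] by simp
    then show ?thesis using identity_coset[OF ran_id(1)[OF xc]] by simp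
  qed
  then show "coset ` M \<subseteq> identities Q" unfolding identities_def by auto
qed

text \<open>
  Since every coset is represented in \<open>M\<close>, conjugation in the quotient can be computed with
  representatives from \<open>M\<close>, where \<open>M'\<close> is normal.
\<close>

lemma normal_image:
  assumes M: "subgroupoid M G" and M': "normal_subgroupoid M' (restrict_to G M)"
    and cover: "coset ` M = coset ` carrier G"
  shows "normal_subgroupoid (coset ` M') Q"
proof -
  note n = M'[unfolded normal_restrict_iff[OF M]]
  then have s': "subgroupoid M' G" and MM: "M' \<subseteq> M" by auto
  note D = subgroupoidD[OF M] and D' = subgroupoidD[OF s']
  have "subgroupoid (coset ` M') Q"
  proof (rule quot.subgroupoidI)
    show "coset ` M' \<subseteq> carrier Q" using carrier_quotient D' by auto
    show "coset ` M' \<noteq> {}" using s' unfolding subgroupoid_def by auto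
    show "ginv Q A \<in> coset ` M'" if "A \<in> coset ` M'" for A
      using that ginv_coset D' by auto
    show "gprod Q A B \<in> coset ` M'"
      if A: "A \<in> coset ` M'" and B: "B \<in> coset ` M'" and d: "dom_id Q A = ran_id Q B" for A B
    proof -
      obtain a b where ab: "a \<in> M'" "b \<in> M'" "A = coset a" "B = coset b" using A B by auto
      have "composable Q A B" using quot.composable_iff ab carrier_quotient D' d by simp
      then have c: "composable G a b" using composable_cosets ab D' by simp
      then have "gprod G a b \<in> M'" using D' ab composable_iff by simp
      then show ?thesis using gprod_quotient[OF normal c] ab by simp
    qed
  qed
  moreover have "ran_id Q A \<in> coset ` M'" if A: "A \<in> carrier Q" for A
  proof -
    obtain a where "a \<in> M" "A = coset a" using A unfolding carrier_quotient cover[symmetric] by (elim imageE)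
    then show ?thesis using ran_coset D n by simp
  qed
  moreover have "gprod Q (gprod Q (ginv Q A) B) A \<in> coset ` M'"
    if A: "A \<in> carrier Q" and B: "B \<in> coset ` M'"
      and d: "dom_id Q B = ran_id Q A" "ran_id Q B = ran_id Q A" for A B
  proof -
    obtain a where a: "a \<in> M" "A = coset a" using A unfolding carrier_quotient cover[symmetric] by (elim imageE)
    obtain b where b: "b \<in> M'" "B = coset b" using B by auto
    have c: "a \<in> carrier G" "b \<in> carrier G" using a b D D' by auto
    note i = ginv_ids[OF c(1)]
    have ids: "A \<in> carrier Q" "B \<in> carrier Q" using carrier_quotient a b c by auto
    have "composable Q B A" "composable Q (ginv Q A) B"
      using quot.composable_iff ids d quot.ginv_ids[OF ids(1)] by auto
    then have ba: "composable G b a" and ib: "composable G (ginv G a) b"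
      using composable_cosets a b c i ginv_coset[OF c(1)] by auto
    have r: "dom_id G b = ran_id G a" "ran_id G b = ran_id G a"
      using ba ib i composable_iff by auto
    have iba: "composable G (gprod G (ginv G a) b) a" using composable_triple(2)[OF ib ba] .
    have "gprod Q (gprod Q (ginv Q A) B) A = coset (gprod G (gprod G (ginv G a) b) a)"
      using gprod_quotient[OF normal] ib iba a b ginv_coset[OF c(1)] by simp
    then show ?thesis using n a b r by auto
  qed
  ultimately show ?thesis unfolding quot.normal_subgroupoid_iff by blast
qed

text \<open>
  Along a descending chain of subgroupoids, each normal in its predecessor, the image in a simple
  quotient stays everything until it becomes trivial in a single step.
\<close>

lemma simple_quotient_dichotomy:
  assumes "simple_groupoid Q" and M: "subgroupoid M G" and M': "normal_subgroupoid M' (restrict_to G M)"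
    and "coset ` M = coset ` carrier G"
  shows "coset ` M' = coset ` carrier G \<or> M' \<subseteq> N"
proof -
  have "coset ` M' = carrier Q \<or> coset ` M' = identities Q"
    using normal_image assms unfolding simple_groupoid_def by blast
  moreover have "subgroupoid M' G" using M' normal_restrict_iff[OF M] by simp
  ultimately show ?thesis using image_subset_identities_iff[of M'] carrier_quotient by (elim disjE) simp_all
qed

end

context groupoid
begin

text \<open>
  This is the second isomorphism theorem applied twice: both quotients are isomorphic to the quotient
  of \<open>H \<inter> K\<close> by \<open>N \<inter> N'\<close>. The map sends the \<open>N\<close>-coset of an element of \<open>H \<inter> K\<close> to its \<open>N'\<close>-coset.
\<close>

lemma isomorphic_quotients:
  assumes H: "subgroupoid H G" and K: "subgroupoid K G"
    and N: "groupoid_quotient (restrict_to G H) N" and N': "groupoid_quotient (restrict_to G K) N'"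
    and cover: "left_coset G N ` (H \<inter> K) = left_coset G N ` H"
    and cover': "left_coset G N' ` (H \<inter> K) = left_coset G N' ` K"
    and sub: "H \<inter> N' \<subseteq> N" "K \<inter> N \<subseteq> N'"
  shows "isomorphic_groupoids (quotient_groupoid (restrict_to G H) N) (quotient_groupoid (restrict_to G K) N')"
proof -
  interpret q: groupoid_quotient "restrict_to G H" N by (fact N)
  interpret q': groupoid_quotient "restrict_to G K" N' by (fact N')
  have NH: "N \<subseteq> H" and NK: "N' \<subseteq> K"
    using q.subgroupoid_normal q'.subgroupoid_normal unfolding subgroupoid_def by auto
  have HG: "H \<subseteq> carrier G" and KG: "K \<subseteq> carrier G" using H K unfolding subgroupoid_def by auto
  note c = left_coset_restrict[OF H NH] and c' = left_coset_restrict[OF K NK]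
  define f where "f = left_coset G N"
  define g where "g = left_coset G N'"
  have carrier: "carrier q.Q = f ` (H \<inter> K)" "carrier q'.Q = g ` (H \<inter> K)"
    unfolding q.carrier_quotient q'.carrier_quotient f_def g_def cover cover' using c c' by auto
  (* For x and y in H \<inter> K the quotient of x by y lies in H \<inter> K, where N and N' agree. *)
  have eq: "f x = f y \<longleftrightarrow> g x = g y" if x: "x \<in> H \<inter> K" and y: "y \<in> H \<inter> K" for x y
  proof -
    have "gprod G (ginv G y) x \<in> N \<longleftrightarrow> gprod G (ginv G y) x \<in> N'" if r: "ran_id G x = ran_id G y"
    proof -
      have "dom_id G (ginv G y) = ran_id G x" using ginv_ids[of y] y HG r by auto
      then have "gprod G (ginv G y) x \<in> H \<inter> K"
        using subgroupoidD[OF H] subgroupoidD[OF K] x y by simp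
      then show ?thesis using sub by blast
    qed
    then show ?thesis
      using q.coset_eq_iff[of x y] q'.coset_eq_iff[of x y] c c' x y
        dom_id_restrict[OF H] dom_id_restrict[OF K] ginv_restrict[OF H] ginv_restrict[OF K]
      unfolding f_def g_def gprod_restrict by auto
  qed
  define \<phi> where "\<phi> = (\<lambda>A. g (inv_into (H \<inter> K) f A))"
  have \<phi>: "\<phi> (f x) = g x" if x: "x \<in> H \<inter> K" for x
  proof -
    have "f x \<in> f ` (H \<inter> K)" using x by simp
    from inv_into_into[OF this] f_inv_into_f[OF this] show ?thesis
      unfolding \<phi>_def using eq x by blast
  qed
  have "bij_betw \<phi> (carrier q.Q) (carrier q'.Q)"
    unfolding bij_betw_def carrier inj_on_def using \<phi> eq by (auto simp: image_iff)
  moreover have "composable q'.Q (\<phi> A) (\<phi> B) \<and> \<phi> (gprod q.Q A B) = gprod q'.Q (\<phi> A) (\<phi> B)"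
    if AB: "composable q.Q A B" for A B
  proof -
    obtain x y where xy: "x \<in> H \<inter> K" "y \<in> H \<inter> K" "A = f x" "B = f y"
      using q.quot.composable_carrier[OF AB] unfolding carrier(1) by (elim conjE imageE)
    have "composable (restrict_to G H) x y"
      using AB q.composable_cosets[of x y] xy c unfolding f_def by simp
    then have d: "dom_id G x = ran_id G y" using composable_restrict[OF HG] by simp
    have p: "gprod G x y \<in> H \<inter> K" using subgroupoidD(3)[OF H] subgroupoidD(3)[OF K] xy d by simp
    have xy1: "composable (restrict_to G H) x y" and xy2: "composable (restrict_to G K) x y"
      using composable_restrict[OF HG] composable_restrict[OF KG] xy d by auto
    have "gprod q.Q A B = f (gprod G x y)" "gprod q'.Q (g x) (g y) = g (gprod G x y)"
      using q.gprod_quotient[OF q.normal xy1] q'.gprod_quotient[OF q'.normal xy2] c c' xy p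
      unfolding f_def g_def gprod_restrict by auto
    moreover have "composable q'.Q (g x) (g y)"
      using q'.composable_cosets[of x y] xy2 xy c' unfolding g_def by simp
    ultimately show ?thesis using \<phi> xy p by simp
  qed
  ultimately show ?thesis unfolding isomorphic_groupoids_def groupoid_iso_def by blast
qed

section \<open>Linked indices of two composition series\<close>

lemma composition_seriesD:
  assumes S: "composition_series G S n"
  shows "S 0 = carrier G" "S n = identities G" "\<And>i. i \<le> n \<Longrightarrow> subgroupoid (S i) G"
    "\<And>i j. i \<le> j \<Longrightarrow> j \<le> n \<Longrightarrow> S j \<subseteq> S i"
    "\<And>i x. i \<le> n \<Longrightarrow> x \<in> carrier G \<Longrightarrow> dom_id G x \<in> S i"
    "\<And>i. i < n \<Longrightarrow> groupoid_quotient (restrict_to G (S i)) (S (Suc i))"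
    "\<And>i. i < n \<Longrightarrow> simple_groupoid (quotient_groupoid (restrict_to G (S i)) (S (Suc i)))"
proof -
  show "S 0 = carrier G" and Sn: "S n = identities G" and s: "\<And>i. i \<le> n \<Longrightarrow> subgroupoid (S i) G"
    using S unfolding composition_series_def subnormal_series_def by auto
  show simple: "\<And>i. i < n \<Longrightarrow> simple_groupoid (quotient_groupoid (restrict_to G (S i)) (S (Suc i)))"
    using S unfolding composition_series_def series_factor_def by auto
  show mono: "S j \<subseteq> S i" if "i \<le> j" "j \<le> n" for i j
    using that
  proof (induction j rule: dec_induct)
    case (step k)
    then have "S (Suc k) \<subseteq> S k"
      using S unfolding composition_series_def subnormal_series_def by auto
    then show ?case using step by auto
  qed simp
  show "dom_id G x \<in> S i" if "i \<le> n" "x \<in> carrier G" for i x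
    using mono[OF that(1)] dom_id(1)[OF that(2)] Sn unfolding identities_def by auto
  show "groupoid_quotient (restrict_to G (S i)) (S (Suc i))" if i: "i < n" for i
    using i groupoid_restrict[OF s[of i]] simple[OF i] S
    unfolding groupoid_quotient_def groupoid_quotient_axioms_def simple_groupoid_def
      composition_series_def subnormal_series_def by simp
qed

end

text \<open>
  The first condition says \<open>S i = (S i \<inter> T j) S (i + 1)\<close>; writing it with images gives it the
  form of the covering hypotheses of \<open>simple_quotient_dichotomy\<close> and \<open>isomorphic_quotients\<close>.
\<close>

definition linked :: "'a partial_magma \<Rightarrow> (nat \<Rightarrow> 'a set) \<Rightarrow> (nat \<Rightarrow> 'a set) \<Rightarrow> nat \<Rightarrow> nat \<Rightarrow> bool" where
  "linked G S T i j \<longleftrightarrow>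
     left_coset G (S (Suc i)) ` (S i \<inter> T j) = left_coset G (S (Suc i)) ` S i \<and>
     S i \<inter> T (Suc j) \<subseteq> S (Suc i)"

lemma linked_cosetD:
  assumes "linked G S T i j" "x \<in> S i"
  obtains y where "y \<in> S i" "y \<in> T j" "left_coset G (S (Suc i)) x = left_coset G (S (Suc i)) y"
proof -
  have "left_coset G (S (Suc i)) x \<in> left_coset G (S (Suc i)) ` (S i \<inter> T j)"
    using assms unfolding linked_def by simp
  then show ?thesis using that by (elim imageE IntE)
qed

lemma linked_memD: "linked G S T i j \<Longrightarrow> x \<in> S i \<Longrightarrow> x \<in> T (Suc j) \<Longrightarrow> x \<in> S (Suc i)"
  unfolding linked_def by (simp add: subset_iff)

context groupoid
begin

lemma series_Int:
  assumes S: "composition_series G S n" and T: "composition_series G T m" and "i \<le> n" "j \<le> m"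
  shows "S i \<inter> T j \<noteq> {}"
proof -
  obtain x where "x \<in> S i" using composition_seriesD(3)[OF S, of i] assms unfolding subgroupoid_def by auto
  then have "x \<in> carrier G" using subgroupoidD(1)[OF composition_seriesD(3)[OF S]] assms by blast
  then show ?thesis using composition_seriesD(5)[OF S] composition_seriesD(5)[OF T] assms by blast
qed

lemma linked_exists:
  assumes S: "composition_series G S n" and T: "composition_series G T m"
    and i: "i \<in> nontrivial_indices S n"
  obtains j where "j < m" "linked G S T i j"
proof -
  have il: "i < n" "S i \<noteq> S (Suc i)" using i unfolding nontrivial_indices_def by auto
  define c where "c = left_coset G (S (Suc i))"
  have SS: "S (Suc i) \<subseteq> S i" using composition_seriesD(4)[OF S, of i "Suc i"] il by simp
  have Si: "subgroupoid (S i) G" "subgroupoid (S (Suc i)) G" using composition_seriesD(3)[OF S] il by auto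
  interpret q: groupoid_quotient "restrict_to G (S i)" "S (Suc i)"
    using composition_seriesD(6)[OF S] il by simp
  have qc: "q.coset x = c x" if "x \<in> S i" for x
    using left_coset_restrict[OF Si(1) SS that] unfolding c_def .
  have im: "q.coset ` A = c ` A" if "A \<subseteq> S i" for A using that qc by (auto intro!: image_cong)
  have sub: "subgroupoid (S i \<inter> T j) (restrict_to G (S i))" if "j \<le> m" for j
    using subgroupoid_restrict[OF Si(1)] subgroupoid_Int[OF Si(1) composition_seriesD(3)[OF T that]]
      series_Int[OF S T _ that] il by simp
  (* The sought j is the last index at which T j still covers the factor S i / S (i + 1). *)
  define covers where "covers j \<longleftrightarrow> c ` (S i \<inter> T j) = c ` S i" for j
  have "S i \<inter> T 0 = S i" using composition_seriesD(1)[OF T] Si unfolding subgroupoid_def by auto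
  then have c0: "covers 0" unfolding covers_def by simp
  (* T m consists of identities, and identities cover only a trivial factor. *)
  have cm: "\<not> covers m"
  proof
    assume cov: "covers m"
    have "S n \<subseteq> S (Suc i)" using composition_seriesD(4)[OF S, of "Suc i" n] il by simp
    then have "S i \<inter> T m \<subseteq> S (Suc i)"
      using composition_seriesD(2)[OF S] composition_seriesD(2)[OF T] by auto
    then have "q.coset ` (S i \<inter> T m) \<subseteq> identities q.Q"
      using q.image_subset_identities_iff[OF sub[of m]] by simp
    then have "q.coset ` S i \<subseteq> identities q.Q" using cov im unfolding covers_def by simp
    then have "S i \<subseteq> S (Suc i)"
      using q.image_subset_identities_iff[of "S i"] subgroupoid_restrict[OF Si(1)] Si by simp
    then show False using SS il by auto
  qed
  obtain j where j: "j < m" "covers j" "\<not> covers (Suc j)"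
    using ex_least_nat_less[of "\<lambda>j. \<not> covers j" m] c0 cm by auto
  have Tj: "subgroupoid (T j) G" "normal_subgroupoid (T (Suc j)) (restrict_to G (T j))"
    using composition_seriesD(3,6)[OF T] j groupoid_quotient.normal by auto
  have "normal_subgroupoid (S i \<inter> T (Suc j)) (restrict_to G (S i \<inter> T j))"
    using normal_restrict_Int[OF Si(1) Tj(1) _ Tj(2)] series_Int[OF S T] il j by simp
  then have "normal_subgroupoid (S i \<inter> T (Suc j)) (restrict_to (restrict_to G (S i)) (S i \<inter> T j))"
    by simp
  moreover have "q.coset ` (S i \<inter> T j) = q.coset ` carrier (restrict_to G (S i))"
    using j im unfolding covers_def by simp
  moreover have "q.coset ` (S i \<inter> T (Suc j)) \<noteq> q.coset ` carrier (restrict_to G (S i))"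
    using j im unfolding covers_def by simp
  ultimately have "S i \<inter> T (Suc j) \<subseteq> S (Suc i)"
    using q.simple_quotient_dichotomy[OF composition_seriesD(7)[OF S il(1)] sub[of j]] j by (meson less_imp_le)
  then have "linked G S T i j" using j unfolding linked_def covers_def c_def by simp
  then show ?thesis using that j by blast
qed

text \<open>
  A coset other than the cosets of identities is represented in \<open>S i \<inter> T j\<close>, because that
  intersection meets every coset.
\<close>

lemma linked_witness:
  assumes S: "composition_series G S n" and i: "i \<in> nontrivial_indices S n" and l: "linked G S T i j"
  obtains x where "x \<in> S i \<inter> T j" "x \<notin> S (Suc i)"
proof -
  have il: "i < n" "S i \<noteq> S (Suc i)" using i unfolding nontrivial_indices_def by auto
  have N: "subgroupoid (S (Suc i)) G" using composition_seriesD(3)[OF S, of "Suc i"] il by simp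
  have "S (Suc i) \<subseteq> S i" using composition_seriesD(4)[OF S, of i "Suc i"] il by simp
  then obtain x where x: "x \<in> S i" "x \<notin> S (Suc i)" using il by auto
  obtain y where y: "y \<in> S i" "y \<in> T j" "left_coset G (S (Suc i)) x = left_coset G (S (Suc i)) y"
    using linked_cosetD[OF l x(1)] .
  have c: "x \<in> carrier G" "y \<in> carrier G" "dom_id G x \<in> S (Suc i)"
    using subgroupoidD(1)[OF composition_seriesD(3)[OF S, of i]] composition_seriesD(5)[OF S, of "Suc i" x]
      il x y by simp_all
  have "y \<notin> S (Suc i)"
    using mem_of_left_coset_eq[OF N N c(1,3) _ y(3)] left_coset_eq_iff[OF N c(1,3,2)] x(2) y(3) by blast
  then show ?thesis using that y by blast
qed

text \<open>
  If \<open>a < b\<close> were both linked to \<open>i\<close>, then \<open>S i \<inter> T b\<close>, being contained in \<open>S i \<inter> T (a + 1)\<close>,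
  would lie in \<open>S (i + 1)\<close>, and the cosets of its elements could not exhaust a nontrivial factor.
\<close>

lemma linked_unique:
  assumes S: "composition_series G S n" and T: "composition_series G T m"
    and i: "i \<in> nontrivial_indices S n" and "j < m" "j' < m"
    and l: "linked G S T i j" "linked G S T i j'"
  shows "j = j'"
proof -
  have "\<not> a < b" if a: "linked G S T i a" and b: "linked G S T i b" "b < m" for a b
  proof
    assume "a < b"
    then have "T b \<subseteq> T (Suc a)" using composition_seriesD(4)[OF T, of "Suc a" b] b(2) by simp
    moreover obtain x where "x \<in> S i \<inter> T b" "x \<notin> S (Suc i)" using linked_witness[OF S i b(1)] .
    ultimately show False using linked_memD[OF a, of x] by auto
  qed
  then show ?thesis using assms by (meson linorder_neqE_nat)
qed

text \<open>
  An element \<open>x\<close> of \<open>S i \<inter> T j\<close> outside \<open>S (i + 1)\<close> is also outside \<open>T (j + 1)\<close>, so \<open>j\<close> is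
  nontrivial and linked to some \<open>i'\<close>. If \<open>i' < i\<close>, then \<open>x\<close> lies in \<open>T j \<inter> S (i' + 1)\<close>, which is
  contained in \<open>T (j + 1)\<close>. If \<open>i < i'\<close>, then \<open>x\<close> is a product of an element of \<open>S i'\<close> and an
  element of \<open>S i \<inter> T (j + 1)\<close>, both contained in \<open>S (i + 1)\<close>.
\<close>

lemma linked_sym:
  assumes S: "composition_series G S n" and T: "composition_series G T m"
    and i: "i \<in> nontrivial_indices S n" and j: "j < m" and l: "linked G S T i j"
  shows "j \<in> nontrivial_indices T m" "linked G T S j i"
proof -
  have il: "i < n" using i unfolding nontrivial_indices_def by simp
  obtain x where x: "x \<in> S i" "x \<in> T j" "x \<notin> S (Suc i)" using linked_witness[OF S i l] by auto
  have xT: "x \<notin> T (Suc j)" using x linked_memD[OF l] by auto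
  show jn: "j \<in> nontrivial_indices T m" unfolding nontrivial_indices_def using j x xT by auto
  obtain i' where i': "i' < n" "linked G T S j i'" using linked_exists[OF T S jn] .
  have "\<not> i' < i"
  proof
    assume "i' < i"
    then have "x \<in> S (Suc i')" using composition_seriesD(4)[OF S, of "Suc i'" i] il x by auto
    then show False using linked_memD[OF i'(2) x(2)] xT by simp
  qed
  moreover have "\<not> i < i'"
  proof
    assume "i < i'"
    then have SS: "S i' \<subseteq> S (Suc i)" "S (Suc i) \<subseteq> S i"
      using composition_seriesD(4)[OF S, of "Suc i" i'] composition_seriesD(4)[OF S, of i "Suc i"] i' by auto
    have sg: "subgroupoid (T (Suc j)) G" "subgroupoid (S i) G" "subgroupoid (S (Suc i)) G"
      using composition_seriesD(3)[OF S] composition_seriesD(3)[OF T] il j by auto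
    obtain s where s: "s \<in> T j" "s \<in> S i'" "left_coset G (T (Suc j)) x = left_coset G (T (Suc j)) s"
      using linked_cosetD[OF i'(2) x(2)] .
    have sS: "s \<in> S (Suc i)" "s \<in> S i" using s SS by auto
    have xc: "x \<in> carrier G" and sc: "s \<in> carrier G" using subgroupoidD(1)[OF sg(2)] x sS by auto
    have dx: "dom_id G x \<in> T (Suc j)" using composition_seriesD(5)[OF T _ xc] j by simp
    have rx: "ran_id G x = ran_id G s" and t: "gprod G (ginv G s) x \<in> T (Suc j)"
      using left_coset_eq_iff[OF sg(1) xc dx sc] s by auto
    have "gprod G (ginv G s) x \<in> S i"
      using subgroupoidD(2,3)[OF sg(2)] x sS ginv_ids[OF sc] rx by simp
    then have "gprod G (ginv G s) x \<in> S (Suc i)" using t linked_memD[OF l] by simp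
    then show False using mem_of_left_coset_eq[OF sg(1) sg(3) xc dx sS(1) s(3)] x by simp
  qed
  ultimately show "linked G T S j i" using i' by (metis linorder_neqE_nat)
qed

lemma isomorphic_linked_factors:
  assumes S: "composition_series G S n" and T: "composition_series G T m" and "i < n" "j < m"
    and "linked G S T i j" "linked G T S j i"
  shows "isomorphic_groupoids (series_factor G S i) (series_factor G T j)"
  unfolding series_factor_def
proof (rule isomorphic_quotients)
  show "subgroupoid (S i) G" "subgroupoid (T j) G"
    "groupoid_quotient (restrict_to G (S i)) (S (Suc i))"
    "groupoid_quotient (restrict_to G (T j)) (T (Suc j))"
    using composition_seriesD(3,6)[OF S] composition_seriesD(3,6)[OF T] assms by auto
  show "left_coset G (S (Suc i)) ` (S i \<inter> T j) = left_coset G (S (Suc i)) ` S i"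
    "left_coset G (T (Suc j)) ` (S i \<inter> T j) = left_coset G (T (Suc j)) ` T j"
    "S i \<inter> T (Suc j) \<subseteq> S (Suc i)" "T j \<inter> S (Suc i) \<subseteq> T (Suc j)"
    using assms(5,6) unfolding linked_def by (simp_all add: Int_commute)
qed

end

theorem proposition4p8:
  fixes G :: "'a partial_magma"
    and S T :: "nat \<Rightarrow> 'a set"
    and n m :: nat
  assumes "groupoid G"
    and "composition_series G S n"
    and "composition_series G T m"
  shows "equivalent_series G S n T m"
proof -
  interpret groupoid G by (fact assms(1))
  note S = assms(2) and T = assms(3)
  define \<pi> where "\<pi> i = (SOME j. j < m \<and> linked G S T i j)" for i
  have \<pi>: "\<pi> i < m" "linked G S T i (\<pi> i)" if "i \<in> nontrivial_indices S n" for i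
    using someI_ex[of "\<lambda>j. j < m \<and> linked G S T i j"] linked_exists[OF S T that] unfolding \<pi>_def by blast+
  have \<pi>': "\<pi> i \<in> nontrivial_indices T m" "linked G T S (\<pi> i) i" if "i \<in> nontrivial_indices S n" for i
    using linked_sym[OF S T that] \<pi>[OF that] by blast+
  have less: "i < n" if "i \<in> nontrivial_indices S n" for i
    using that unfolding nontrivial_indices_def by simp
  have "inj_on \<pi> (nontrivial_indices S n)"
    using linked_unique[OF T S] \<pi>' less unfolding inj_on_def by metis
  moreover have "j \<in> \<pi> ` nontrivial_indices S n" if j: "j \<in> nontrivial_indices T m" for j
  proof -
    obtain i where i: "i < n" "linked G T S j i" using linked_exists[OF T S j] .
    have "i \<in> nontrivial_indices S n" "linked G S T i j" using linked_sym[OF T S j i] .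
    moreover have "j < m" using j unfolding nontrivial_indices_def by simp
    ultimately show ?thesis using linked_unique[OF S T] \<pi> by blast
  qed
  ultimately have "bij_betw \<pi> (nontrivial_indices S n) (nontrivial_indices T m)"
    using \<pi>' unfolding bij_betw_def by blast
  moreover have "isomorphic_groupoids (series_factor G S i) (series_factor G T (\<pi> i))"
    if "i \<in> nontrivial_indices S n" for i
    using isomorphic_linked_factors[OF S T] less \<pi> \<pi>' that by blast
  ultimately show ?thesis unfolding equivalent_series_def by blast
qed

end
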